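(* Let $\gamma>0$, let $\phi:[0,\infty)\to\mathbb{R}$ satisfy $\phi(1)=-1$ and $\phi(z)\ge -z^{1+\gamma}$ for all $z\ge0$, and let $S_\phi$ and $S_{\mathrm{power}}$ be the Hölder score and the density-power score with parameter $\gamma$. Let $\{p_\theta:\theta\in\Theta\}$ be a parametric family of probability densities with $\Theta\subset\mathbb{R}^d$ open, let $p_0=p_{\theta_0}$ with $\theta_0\in\Theta$, let $c_0\in(0,1]$, let $w$ be a probability density, and put $$p(x)=c_0p_0(x)+(1-c_0)w(x),\qquad \xi_0=(c_0,\theta_0).$$ Suppose that $\xi_1=(c_1,\theta_1)$ is the unique optimal solution of $$\min_{c,\theta}\ S_\phi(p,cp_\theta)\quad\text{subject to } c>0,\ \theta\in\Theta .$$ Define, as functions of $\xi=(c,\theta)$, $$f_0(\xi)=S_{\mathrm{power}}(c_0p_0,cp_\theta),\qquad f_1(\xi)=S_{\mathrm{power}}(p,cp_\theta).$$ For $\xi_1=(c_1,\theta_1)$ and $\varepsilon_1=\int w(x)p_{\theta_1}(x)^\gamma dx$, let $\mathcal N$ be a convex set satisfying $$\{\xi\in(0,1]\times\Theta \mid f_1(\xi)\le f_1(\xi_1)+(1+\gamma)\varepsilon_1\}\subset\mathcal N .$$ Suppose that $f_0$ is second order differentiable on $\mathcal N$. Let $H_\xi$ be the Hessian matrix of $f_0(\xi)$, and suppose that there exists a positive real number $\delta$ such that all eigenvalues of $H_\xi$, $\xi\in\mathcal N$, are greater than $\delta$. Then $$\|\xi_1-\xi_0\|=O(\varepsilon_1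^{1/2}).$$
   Context: For a function $f$ write $\langle f\rangle=\int f(x)\,dx$. For non-negative functions $f,g$: $$S_\phi(f,g)=\phi\!\left(\frac{\langle fg^\gamma\rangle}{\langle g^{1+\gamma}\rangle}\right)\langle g^{1+\gamma}\rangle,\qquad S_{\mathrm{power}}(f,g)=\gamma\langle g^{1+\gamma}\rangle-(1+\gamma)\langle fg^\gamma\rangle .$$ (The density-power score is the Hölder score with $\phi(z)=\gamma-(1+\gamma)z$.) The density $p$ is a contaminated version of the target density $p_0$, with contamination density $w$ and contamination ratio $1-c_0$; the scaled model $cp_\theta$ with $c>0$ is used to estimate both $\theta_0$ and $c_0$. The norm $\|\cdot\|$ is the norm on $\mathbb{R}^{1+d}$.
   Formalization: The formal theorem adds the hypothesis c_1 ≤ 1, so that ξ_1 lies in (0,1]×Θ and hence in N; without it the claim fails, as ξ_1 with c_1 > 1 may lie far from N while ε_1 → 0. Finiteness of the scores and of ε_1, and N ⊂ (0,∞)×Θ, are stated explicitly. *)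

theory Defs
  imports "HOL-Analysis.Analysis"
begin

definition prob_density :: "('x::euclidean_space \<Rightarrow> real) \<Rightarrow> bool" where
  "prob_density f \<longleftrightarrow>
     (\<forall>x. 0 \<le> f x) \<and> integrable lebesgue f \<and> (LINT x|lebesgue. f x) = 1"

definition holder_score ::
  "real \<Rightarrow> (real \<Rightarrow> real) \<Rightarrow> ('x::euclidean_space \<Rightarrow> real) \<Rightarrow> ('x \<Rightarrow> real) \<Rightarrow> real" where
  "holder_score \<gamma> \<phi> f g =
     \<phi> ((LINT x|lebesgue. f x * g x powr \<gamma>) / (LINT x|lebesgue. g x powr (1 + \<gamma>)))
       * (LINT x|lebesgue. g x powr (1 + \<gamma>))"

definition power_score ::
  "real \<Rightarrow> ('x::euclidean_space \<Rightarrow> real) \<Rightarrow> ('x \<Rightarrow> real) \<Rightarrow> real" where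
  "power_score \<gamma> f g =
     \<gamma> * (LINT x|lebesgue. g x powr (1 + \<gamma>))
       - (1 + \<gamma>) * (LINT x|lebesgue. f x * g x powr \<gamma>)"

lemma holder_score_power:
  assumes "(LINT x|lebesgue. g x powr (1 + \<gamma>)) \<noteq> 0"
  shows "holder_score \<gamma> (\<lambda>z. \<gamma> - (1 + \<gamma>) * z) f g = power_score \<gamma> f g"
  using assms by (simp add: holder_score_def power_score_def left_diff_distrib)

definition contaminated ::
  "real \<Rightarrow> ('x \<Rightarrow> real) \<Rightarrow> ('x \<Rightarrow> real) \<Rightarrow> 'x \<Rightarrow> real" where
  "contaminated c p\<^sub>0 w = (\<lambda>x. c * p\<^sub>0 x + (1 - c) * w x)"

definition unique_minimizer :: "('a \<Rightarrow> real) \<Rightarrow> 'a set \<Rightarrow> 'a \<Rightarrow> bool" where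
  "unique_minimizer F A a \<longleftrightarrow>
     is_arg_min F (\<lambda>x. x \<in> A) a \<and> (\<forall>b. is_arg_min F (\<lambda>x. x \<in> A) b \<longrightarrow> b = a)"

definition gradient :: "('a::euclidean_space \<Rightarrow> real) \<Rightarrow> 'a \<Rightarrow> 'a" where
  "gradient f x = (THE D. GDERIV f x :> D)"

definition twice_differentiable_at :: "('a::euclidean_space \<Rightarrow> real) \<Rightarrow> 'a \<Rightarrow> bool" where
  "twice_differentiable_at f x \<longleftrightarrow>
     (\<forall>\<^sub>F y in nhds x. f differentiable (at y)) \<and> gradient f differentiable (at x)"

(* Matrices over a Euclidean space are indexed by its standard basis; thus the Hessian
   with respect to (c, \<theta>) in real \<times> real ^ 'd is a square matrix of size 1 + CARD('d). *)

definition hessian :: "('a::euclidean_space \<Rightarrow> real) \<Rightarrow> 'a \<Rightarrow> 'a \<Rightarrow> 'a \<Rightarrow> real" where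
  "hessian f x i j = frechet_derivative (gradient f) (at x) j \<bullet> i"

definition basis_eigenvalue :: "('a::euclidean_space \<Rightarrow> 'a \<Rightarrow> real) \<Rightarrow> real \<Rightarrow> bool" where
  "basis_eigenvalue A \<mu> \<longleftrightarrow>
     (\<exists>v. v \<noteq> 0 \<and> (\<forall>i\<in>Basis. (\<Sum>j\<in>Basis. A i j * (v \<bullet> j)) = \<mu> * (v \<bullet> i)))"

end

theory Submission
  imports Defs
begin

text \<open>
  For a fixed shape \<open>g\<close>, put \<open>A = \<langle>q g\<^sup>\<gamma>\<rangle>\<close> and \<open>B = \<langle>g\<^sup>1\<^sup>+\<^sup>\<gamma>\<rangle>\<close>. If \<open>A > 0\<close>, then both the Hoelder score
  and the density-power score of \<open>q\<close> against \<open>c g\<close> are minimal over \<open>c > 0\<close> at \<open>c = A / B\<close>, with the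
  same value \<open>- B (A / B)\<^sup>1\<^sup>+\<^sup>\<gamma>\<close>. Hence the unique minimiser \<open>\<xi>\<^sub>1\<close> of the Hoelder score sits at the
  optimal scale and satisfies \<open>f\<^sub>1(\<xi>\<^sub>1) \<le> f\<^sub>1(\<xi>\<^sub>0)\<close>
  (lemma \<open>unique_minimizer_holder_score_power_score_le\<close>).

  The contamination changes the density-power score only by the bias
  \<open>f\<^sub>0(c, \<theta>) - f\<^sub>1(c, \<theta>) = (1 + \<gamma>) (1 - c\<^sub>0) c\<^sup>\<gamma> \<langle>w p\<^sub>\<theta>\<^sup>\<gamma>\<rangle>\<close>, which is nonnegative and, at \<open>\<xi>\<^sub>1\<close>, at most
  \<open>(1 + \<gamma>) \<epsilon>\<^sub>1\<close>. By Young's inequality \<open>\<xi>\<^sub>0\<close> minimises \<open>f\<^sub>0\<close> (lemma \<open>power_score_self_le\<close>). These facts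
  put \<open>\<xi>\<^sub>0\<close> and \<open>\<xi>\<^sub>1\<close> into \<open>N\<close> and give \<open>f\<^sub>0(\<xi>\<^sub>1) - f\<^sub>0(\<xi>\<^sub>0) \<le> (1 + \<gamma>) \<epsilon>\<^sub>1\<close>.

  Conversely, the Hessian of \<open>f\<^sub>0\<close> is symmetric, so its smallest eigenvalue bounds its quadratic form
  and exceeds \<open>\<delta>\<close> on \<open>N\<close>. As the gradient vanishes at \<open>\<xi>\<^sub>0\<close>, Taylor's formula along the segment from
  \<open>\<xi>\<^sub>0\<close> to \<open>\<xi>\<^sub>1\<close> gives \<open>\<delta> / 2 \<parallel>\<xi>\<^sub>1 - \<xi>\<^sub>0\<parallel>\<^sup>2 \<le> f\<^sub>0(\<xi>\<^sub>1) - f\<^sub>0(\<xi>\<^sub>0)\<close>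
  (lemma \<open>strongly_convex_growth_at_minimum\<close>). So \<open>C = sqrt (2 (1 + \<gamma>) / \<delta>)\<close> works, and it depends on \<open>\<gamma>\<close> and
  \<open>\<delta>\<close> only.
\<close>

section \<open>Scores of scaled densities\<close>

lemma young_powr:
  fixes a b \<gamma> :: real
  assumes "\<gamma> > 0" "a \<ge> 0" "b \<ge> 0"
  shows "(1 + \<gamma>) * (a * b powr \<gamma>) \<le> a powr (1 + \<gamma>) + \<gamma> * b powr (1 + \<gamma>)"
proof -
  have "a * b powr \<gamma> \<le> a powr (1 + \<gamma>) / (1 + \<gamma>)
      + (b powr \<gamma>) powr ((1 + \<gamma>) / \<gamma>) / ((1 + \<gamma>) / \<gamma>)"
    using assms by (intro Youngs_inequality) (auto simp: field_simps)
  also have "(b powr \<gamma>) powr ((1 + \<gamma>) / \<gamma>) = b powr (1 + \<gamma>)"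
    using assms by (simp add: powr_powr)
  finally have "(1 + \<gamma>) * (a * b powr \<gamma>) \<le> (1 + \<gamma>) *
      (a powr (1 + \<gamma>) / (1 + \<gamma>) + b powr (1 + \<gamma>) / ((1 + \<gamma>) / \<gamma>))"
    using assms by (intro mult_left_mono) auto
  also have "\<dots> = a powr (1 + \<gamma>) + \<gamma> * b powr (1 + \<gamma>)"
    using assms by (simp add: distrib_left)
  finally show ?thesis .
qed

lemma integrable_mult_powr:
  fixes f g :: "'x::euclidean_space \<Rightarrow> real"
  assumes "\<gamma> > 0" "\<And>x. f x \<ge> 0" "\<And>x. g x \<ge> 0"
    and [measurable]: "f \<in> borel_measurable lebesgue" "g \<in> borel_measurable lebesgue"
    and "integrable lebesgue (\<lambda>x. f x powr (1 + \<gamma>))"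
    and "integrable lebesgue (\<lambda>x. g x powr (1 + \<gamma>))"
  shows "integrable lebesgue (\<lambda>x. f x * g x powr \<gamma>)"
proof (rule Bochner_Integration.integrable_bound)
  show "integrable lebesgue (\<lambda>x. f x powr (1 + \<gamma>) + \<gamma> * g x powr (1 + \<gamma>))"
    using assms by simp
  show "(\<lambda>x. f x * g x powr \<gamma>) \<in> borel_measurable lebesgue"
    by measurable
  have "f x * g x powr \<gamma> \<le> f x powr (1 + \<gamma>) + \<gamma> * g x powr (1 + \<gamma>)" for x
  proof -
    have "1 * (f x * g x powr \<gamma>) \<le> (1 + \<gamma>) * (f x * g x powr \<gamma>)"
      using assms by (intro mult_right_mono) auto
    also have "\<dots> \<le> f x powr (1 + \<gamma>) + \<gamma> * g x powr (1 + \<gamma>)"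
      using assms by (intro young_powr) auto
    finally show ?thesis by simp
  qed
  then show "AE x in lebesgue. norm (f x * g x powr \<gamma>)
      \<le> norm (f x powr (1 + \<gamma>) + \<gamma> * g x powr (1 + \<gamma>))"
    using assms by (auto simp: abs_mult)
qed

lemma power_score_self:
  assumes "\<And>x. f x \<ge> 0"
  shows "power_score \<gamma> f f = - (LINT x|lebesgue. f x powr (1 + \<gamma>))"
proof -
  have "f x * f x powr \<gamma> = f x powr (1 + \<gamma>)" for x
    using assms[of x] by (cases "f x = 0") (simp_all add: powr_add)
  then show ?thesis
    by (simp add: power_score_def algebra_simps)
qed

lemma power_score_self_le:
  fixes f g :: "'x::euclidean_space \<Rightarrow> real"
  assumes "\<gamma> > 0" "\<And>x. f x \<ge> 0" "\<And>x. g x \<ge> 0"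
    and "f \<in> borel_measurable lebesgue" "g \<in> borel_measurable lebesgue"
    and f: "integrable lebesgue (\<lambda>x. f x powr (1 + \<gamma>))"
    and g: "integrable lebesgue (\<lambda>x. g x powr (1 + \<gamma>))"
  shows "power_score \<gamma> f f \<le> power_score \<gamma> f g"
proof -
  have fg: "integrable lebesgue (\<lambda>x. f x * g x powr \<gamma>)"
    using assms by (rule integrable_mult_powr)
  have "(LINT x|lebesgue. (1 + \<gamma>) * (f x * g x powr \<gamma>))
      \<le> (LINT x|lebesgue. f x powr (1 + \<gamma>) + \<gamma> * g x powr (1 + \<gamma>))"
    using assms f g fg by (intro integral_mono young_powr) auto
  then have "(1 + \<gamma>) * (LINT x|lebesgue. f x * g x powr \<gamma>)
      \<le> (LINT x|lebesgue. f x powr (1 + \<gamma>)) + \<gamma> * (LINT x|lebesgue. g x powr (1 + \<gamma>))"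
    using f g by simp
  then show ?thesis
    using assms by (simp add: power_score_self) (simp add: power_score_def)
qed

lemma prob_density_integral_powr_pos:
  assumes p: "prob_density p" and int: "integrable lebesgue (\<lambda>x. p x powr s)"
  shows "0 < (LINT x|lebesgue. p x powr s)"
proof (rule ccontr)
  assume "\<not> ?thesis"
  moreover have "0 \<le> (LINT x|lebesgue. p x powr s)" by simp
  ultimately have "(LINT x|lebesgue. p x powr s) = 0" by linarith
  then have "AE x in lebesgue. p x powr s = 0"
    using int by (subst (asm) integral_nonneg_eq_0_iff_AE) auto
  then have "AE x in lebesgue. p x = 0" by simp
  then have "(LINT x|lebesgue. p x) = 0" by (rule integral_eq_zero_AE)
  then show False using p by (simp add: prob_density_def)
qed

lemma integral_scaled_powr:
  fixes f g :: "'x::euclidean_space \<Rightarrow> real"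
  assumes "c > 0" "\<And>x. g x \<ge> 0"
  shows "(LINT x|lebesgue. (c * g x) powr s) = c powr s * (LINT x|lebesgue. g x powr s)"
    and "(LINT x|lebesgue. f x * (c * g x) powr s)
      = c powr s * (LINT x|lebesgue. f x * g x powr s)"
  using assms by (simp_all add: powr_mult mult.left_commute[of "f _"])

lemma power_score_scaled:
  assumes "c > 0" "\<And>x. g x \<ge> 0"
  shows "power_score \<gamma> f (\<lambda>x. c * g x)
    = \<gamma> * (c powr (1 + \<gamma>) * (LINT x|lebesgue. g x powr (1 + \<gamma>)))
      - (1 + \<gamma>) * (c powr \<gamma> * (LINT x|lebesgue. f x * g x powr \<gamma>))"
  using assms by (simp add: power_score_def integral_scaled_powr)

lemma holder_score_scaled:
  assumes "c > 0" "\<And>x. g x \<ge> 0"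
  shows "holder_score \<gamma> \<phi> f (\<lambda>x. c * g x)
    = \<phi> ((LINT x|lebesgue. f x * g x powr \<gamma>) / (LINT x|lebesgue. g x powr (1 + \<gamma>)) / c)
      * (c powr (1 + \<gamma>) * (LINT x|lebesgue. g x powr (1 + \<gamma>)))"
  unfolding holder_score_def integral_scaled_powr[OF assms] using assms
  by (simp add: powr_add mult.commute)

text \<open>In this context \<open>z\<close> is the optimal scale \<open>A / B\<close> of \<open>g\<close>: the density-power score of
  \<open>c g\<close>, and the Hoelder score if \<open>\<phi>(s) \<ge> - s\<^sup>1\<^sup>+\<^sup>\<gamma>\<close> for \<open>s \<ge> 0\<close>, are at least \<open>- B z\<^sup>1\<^sup>+\<^sup>\<gamma>\<close>. If \<open>z > 0\<close> (and \<open>\<phi>(1) = - 1\<close>),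
  this bound is attained at \<open>c = z\<close>.\<close>

context
  fixes \<gamma> A B z :: real and f g :: "'x::euclidean_space \<Rightarrow> real"
  assumes gamma: "\<gamma> > 0" and f: "\<And>x. f x \<ge> 0" and g: "\<And>x. g x \<ge> 0"
  defines "A \<equiv> LINT x|lebesgue. f x * g x powr \<gamma>"
    and "B \<equiv> LINT x|lebesgue. g x powr (1 + \<gamma>)"
  defines "z \<equiv> A / B"
  assumes B: "B > 0"
begin

lemma scale_nonneg: "z \<ge> 0"
  using B f unfolding z_def A_def by (intro divide_nonneg_pos integral_nonneg_AE) auto

lemma holder_score_scaled_eq:
  assumes "c > 0"
  shows "holder_score \<gamma> \<phi> f (\<lambda>x. c * g x) = \<phi> (z / c) * (c powr (1 + \<gamma>) * B)"
  unfolding z_def A_def B_def by (rule holder_score_scaled[OF assms g])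

lemma power_score_scaled_eq:
  assumes "c > 0"
  shows "power_score \<gamma> f (\<lambda>x. c * g x)
    = \<gamma> * (c powr (1 + \<gamma>) * B) - (1 + \<gamma>) * (c powr \<gamma> * (B * z))"
proof -
  have "A = B * z"
    using B by (simp add: z_def)
  then show ?thesis
    using power_score_scaled[where g = g, OF assms g] by (simp add: A_def B_def)
qed

lemma holder_score_scaled_ge:
  assumes "\<forall>z\<ge>0. \<phi> z \<ge> - (z powr (1 + \<gamma>))" "c > 0"
  shows "- (B * z powr (1 + \<gamma>)) \<le> holder_score \<gamma> \<phi> f (\<lambda>x. c * g x)"
proof -
  have "- ((z / c) powr (1 + \<gamma>)) * (c powr (1 + \<gamma>) * B) \<le> \<phi> (z / c) * (c powr (1 + \<gamma>) * B)"
    using assms B scale_nonneg by (intro mult_right_mono) auto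
  moreover have "(z / c) powr (1 + \<gamma>) * (c powr (1 + \<gamma>) * B) = B * z powr (1 + \<gamma>)"
    using assms scale_nonneg by (simp add: powr_divide)
  ultimately show ?thesis
    using assms by (simp add: holder_score_scaled_eq)
qed

lemma holder_score_optimal_scale:
  assumes "\<phi> 1 = - 1" "z > 0"
  shows "holder_score \<gamma> \<phi> f (\<lambda>x. z * g x) = - (B * z powr (1 + \<gamma>))"
  using assms by (simp add: holder_score_scaled_eq mult.commute)

lemma power_score_scaled_ge:
  assumes "c > 0"
  shows "- (B * z powr (1 + \<gamma>)) \<le> power_score \<gamma> f (\<lambda>x. c * g x)"
proof -
  have "B * ((1 + \<gamma>) * (z * c powr \<gamma>)) \<le> B * (z powr (1 + \<gamma>) + \<gamma> * c powr (1 + \<gamma>))"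
    using B assms gamma scale_nonneg by (intro mult_left_mono young_powr) auto
  then show ?thesis
    using assms by (simp add: power_score_scaled_eq algebra_simps)
qed

lemma power_score_optimal_scale:
  assumes "z > 0"
  shows "power_score \<gamma> f (\<lambda>x. z * g x) = - (B * z powr (1 + \<gamma>))"
  using assms by (simp add: power_score_scaled_eq powr_add algebra_simps)

end

text \<open>The minimiser of the Hoelder score also beats, for the density-power score, every competitor
  \<open>(c, \<theta>)\<close> with \<open>\<langle>q p\<^sub>\<theta>\<^sup>\<gamma>\<rangle> > 0\<close>. Existence of such a competitor makes the minimal value negative.
  Uniqueness of the minimiser identifies \<open>c1\<close> with the optimal scale, where the two scores agree.\<close>

lemma unique_minimizer_holder_score_power_score_le:
  fixes p :: "'t \<Rightarrow> 'x::euclidean_space \<Rightarrow> real"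
  assumes gamma: "\<gamma> > 0" and phi1: "\<phi> 1 = - 1" and phi: "\<forall>z\<ge>0. \<phi> z \<ge> - (z powr (1 + \<gamma>))"
    and q: "\<And>x. q x \<ge> 0"
    and p: "\<And>\<theta> x. \<theta> \<in> \<Theta> \<Longrightarrow> p \<theta> x \<ge> 0"
    and pos: "\<And>\<theta>. \<theta> \<in> \<Theta> \<Longrightarrow> 0 < (LINT x|lebesgue. p \<theta> x powr (1 + \<gamma>))"
    and min: "unique_minimizer (\<lambda>(c, \<theta>). holder_score \<gamma> \<phi> q (\<lambda>x. c * p \<theta> x))
                ({0<..} \<times> \<Theta>) (c1, \<theta>1)"
    and c: "c > 0" and th: "\<theta> \<in> \<Theta>" and corr: "0 < (LINT x|lebesgue. q x * p \<theta> x powr \<gamma>)"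
  shows "power_score \<gamma> q (\<lambda>x. c1 * p \<theta>1 x) \<le> power_score \<gamma> q (\<lambda>x. c * p \<theta> x)"
proof -
  define B where "B = (\<lambda>\<theta>. LINT x|lebesgue. p \<theta> x powr (1 + \<gamma>))"
  define z where "z = (\<lambda>\<theta>. (LINT x|lebesgue. q x * p \<theta> x powr \<gamma>) / B \<theta>)"
  let ?S = "\<lambda>c \<theta>. holder_score \<gamma> \<phi> q (\<lambda>x. c * p \<theta> x)"
  let ?F = "\<lambda>(c, \<theta>). ?S c \<theta>" and ?D = "\<lambda>x. x \<in> {0<..} \<times> \<Theta>"
  have arg_min: "is_arg_min ?F ?D (c1, \<theta>1)"
    and unique: "\<And>b. is_arg_min ?F ?D b \<Longrightarrow> b = (c1, \<theta>1)"
    using min unfolding unique_minimizer_def by blast+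
  have c1: "c1 > 0" and th1: "\<theta>1 \<in> \<Theta>"
    using arg_min by (simp_all add: is_arg_min_def)
  have le: "?S c1 \<theta>1 \<le> ?S c \<theta>" if "c > 0" "\<theta> \<in> \<Theta>" for c \<theta>
    using arg_min that unfolding is_arg_min_linorder by fastforce
  have uniq: "c = c1"
    if "c > 0" "\<theta> \<in> \<Theta>" and "\<And>c' \<theta>'. c' > 0 \<Longrightarrow> \<theta>' \<in> \<Theta> \<Longrightarrow> ?S c \<theta> \<le> ?S c' \<theta>'" for c \<theta>
  proof -
    have "is_arg_min ?F ?D (c, \<theta>)"
      using that unfolding is_arg_min_linorder by simp
    then show ?thesis using unique by blast
  qed
  have zpos: "z \<theta> > 0"
    using corr pos[OF th] by (simp add: z_def B_def)
  have Sz: "?S (z \<theta>) \<theta> = - (B \<theta> * z \<theta> powr (1 + \<gamma>))"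
    using holder_score_optimal_scale[of \<gamma> q "p \<theta>" \<phi>] gamma q p[OF th] pos[OF th] phi1 zpos
    by (simp add: z_def B_def)
  have ge1: "- (B \<theta>1 * z \<theta>1 powr (1 + \<gamma>)) \<le> ?S c1 \<theta>1"
    using holder_score_scaled_ge[of \<gamma> q "p \<theta>1" \<phi> c1] gamma q p[OF th1] pos[OF th1] phi c1
    by (simp add: z_def B_def)
  have neg: "- (B \<theta> * z \<theta> powr (1 + \<gamma>)) < 0"
    using zpos pos[OF th] by (simp add: B_def)
  have "z \<theta>1 \<ge> 0"
    using scale_nonneg[of \<gamma> q "p \<theta>1"] gamma q p[OF th1] pos[OF th1] by (simp add: z_def B_def)
  \<comment> \<open>A vanishing optimal scale would make the minimal value nonnegative.\<close>
  moreover have "z \<theta>1 \<noteq> 0"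
    using le[OF zpos th] Sz ge1 neg gamma by auto
  ultimately have z1: "z \<theta>1 > 0" by simp
  have Sz1: "?S (z \<theta>1) \<theta>1 = - (B \<theta>1 * z \<theta>1 powr (1 + \<gamma>))"
    using holder_score_optimal_scale[of \<gamma> q "p \<theta>1" \<phi>] gamma q p[OF th1] pos[OF th1] phi1 z1
    by (simp add: z_def B_def)
  have "?S (z \<theta>1) \<theta>1 \<le> ?S c' \<theta>'" if "c' > 0" "\<theta>' \<in> \<Theta>" for c' \<theta>'
    using le[OF that] ge1 Sz1 by linarith
  then have eq: "z \<theta>1 = c1"
    using uniq[OF z1 th1] by blast
  have "power_score \<gamma> q (\<lambda>x. z \<theta>1 * p \<theta>1 x) = - (B \<theta>1 * z \<theta>1 powr (1 + \<gamma>))"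
    using power_score_optimal_scale[of \<gamma> q "p \<theta>1"] gamma q p[OF th1] pos[OF th1] z1
    by (simp add: z_def B_def)
  then have "power_score \<gamma> q (\<lambda>x. c1 * p \<theta>1 x) = ?S c1 \<theta>1"
    using Sz1 unfolding eq by simp
  also have "\<dots> \<le> ?S (z \<theta>) \<theta>"
    by (rule le[OF zpos th])
  also have "\<dots> \<le> power_score \<gamma> q (\<lambda>x. c * p \<theta> x)"
    using power_score_scaled_ge[of \<gamma> q "p \<theta>" c] gamma q p[OF th] pos[OF th] c Sz
    by (simp add: z_def B_def)
  finally show ?thesis .
qed

section \<open>Gradients and Hessians\<close>

lemma GDERIV_gradient:
  fixes f :: "'a::euclidean_space \<Rightarrow> real"
  assumes "f differentiable (at x)"
  shows "GDERIV f x :> gradient f x"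
proof -
  obtain f' where f': "(f has_derivative f') (at x)"
    using assms by (auto simp: differentiable_def)
  define D where "D = (\<Sum>b\<in>Basis. f' b *\<^sub>R b)"
  have "f' = (\<lambda>h. h \<bullet> D)"
  proof
    fix h
    have "f' h = f' (\<Sum>b\<in>Basis. (h \<bullet> b) *\<^sub>R b)"
      by (simp add: euclidean_representation)
    also have "\<dots> = (\<Sum>b\<in>Basis. (h \<bullet> b) * f' b)"
      using has_derivative_linear[OF f'] by (simp add: linear_sum linear_scale)
    finally show "f' h = h \<bullet> D"
      by (simp add: D_def inner_sum_right mult.commute)
  qed
  then have D: "GDERIV f x :> D"
    using f' by (simp add: gderiv_def)
  have unique: "E = D" if "GDERIV f x :> E" for E
  proof -
    have "(\<lambda>h. h \<bullet> E) = (\<lambda>h. h \<bullet> D)"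
      using that D unfolding gderiv_def by (rule has_derivative_unique)
    then have "h \<bullet> (E - D) = 0" for h by (simp add: fun_eq_iff inner_diff_right)
    from this[of "E - D"] show ?thesis by simp
  qed
  have "gradient f x = D"
    unfolding gradient_def using D unique by (rule the_equality)
  with D show ?thesis by simp
qed

lemma gradient_along_line:
  fixes f :: "'a::euclidean_space \<Rightarrow> real"
  assumes "f differentiable (at (a + t *\<^sub>R v))"
  shows "((\<lambda>t. f (a + t *\<^sub>R v)) has_real_derivative gradient f (a + t *\<^sub>R v) \<bullet> v) (at t)"
proof -
  have "((\<lambda>t. a + t *\<^sub>R v) has_derivative (\<lambda>s. s *\<^sub>R v)) (at t)"
    by (auto intro!: derivative_eq_intros)
  then have "((\<lambda>t. f (a + t *\<^sub>R v)) has_derivative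
      (\<lambda>s. (s *\<^sub>R v) \<bullet> gradient f (a + t *\<^sub>R v))) (at t)"
    using GDERIV_gradient[OF assms] unfolding gderiv_def
    by (rule has_derivative_compose)
  then show ?thesis
    by (simp add: has_field_derivative_def inner_commute mult.commute[of _ "inner _ _"])
qed

text \<open>Mean value theorem for the difference of \<open>f\<close> along two parallel segments in direction \<open>v\<close>, offset
  by \<open>t u\<close>, combined with the linearisation \<open>L\<close> of the gradient at \<open>x\<close>.\<close>

lemma second_difference_estimate:
  fixes f :: "'a::euclidean_space \<Rightarrow> real"
  assumes L: "linear L" and t: "t > 0"
    and diff: "\<And>y. norm (y - x) < d \<Longrightarrow> f differentiable (at y)"
    and grad: "\<And>y. norm (y - x) < d
      \<Longrightarrow> norm (gradient f y - gradient f x - L (y - x)) \<le> e * norm (y - x)"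
    and small: "t * (norm u + norm v) < d" and e: "e \<ge> 0"
  shows "\<bar>(f (x + t *\<^sub>R u + t *\<^sub>R v) - f (x + t *\<^sub>R u) - f (x + t *\<^sub>R v) + f x) - t\<^sup>2 * (L u \<bullet> v)\<bar>
    \<le> t\<^sup>2 * (e * (2 * (norm u + norm v)) * norm v)"
proof -
  let ?G = "gradient f"
  let ?k = "norm u + norm v"
  have n1: "norm (t *\<^sub>R u + s *\<^sub>R v) \<le> t * ?k" and n2: "norm (s *\<^sub>R v) \<le> t * ?k"
    if "0 \<le> s" "s \<le> t" for s
  proof -
    have sv: "s * norm v \<le> t * norm v" using that by (intro mult_right_mono) auto
    have "norm (t *\<^sub>R u + s *\<^sub>R v) \<le> t * norm u + s * norm v"
      using norm_triangle_ineq[of "t *\<^sub>R u" "s *\<^sub>R v"] that t by simp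
    with sv show "norm (t *\<^sub>R u + s *\<^sub>R v) \<le> t * ?k" by (simp add: algebra_simps)
    have "0 \<le> t * norm u" using t by simp
    with sv have "s * norm v \<le> t * norm u + t * norm v" by linarith
    then show "norm (s *\<^sub>R v) \<le> t * ?k" using that by (simp add: distrib_left)
  qed
  define h where "h = (\<lambda>s. f (x + t *\<^sub>R u + s *\<^sub>R v) - f (x + s *\<^sub>R v))"
  have "(h has_real_derivative ?G (x + t *\<^sub>R u + s *\<^sub>R v) \<bullet> v - ?G (x + s *\<^sub>R v) \<bullet> v) (at s)"
    if "0 \<le> s" "s \<le> t" for s
  proof -
    have "norm (x + t *\<^sub>R u + s *\<^sub>R v - x) < d" "norm (x + s *\<^sub>R v - x) < d"
      using n1[OF that] n2[OF that] small by (simp_all only: add.assoc add_diff_cancel_left')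
    then show ?thesis
      unfolding h_def by (intro DERIV_diff gradient_along_line diff)
  qed
  then obtain s where s: "0 < s" "s < t"
    and hs: "h t - h 0 = (t - 0) * (?G (x + t *\<^sub>R u + s *\<^sub>R v) \<bullet> v - ?G (x + s *\<^sub>R v) \<bullet> v)"
    using MVT2[OF t, of h "\<lambda>s. ?G (x + t *\<^sub>R u + s *\<^sub>R v) \<bullet> v - ?G (x + s *\<^sub>R v) \<bullet> v"] by blast
  \<comment> \<open>The remainder in the linearisation of the gradient.\<close>
  define R where "R = (\<lambda>k. ?G (x + k) - ?G x - L k)"
  have R: "norm (R k) \<le> e * (t * ?k)" if "norm k \<le> t * ?k" for k
  proof -
    have "norm (R k) \<le> e * norm k"
      using grad[of "x + k"] that small by (simp add: R_def)
    also have "\<dots> \<le> e * (t * ?k)" using that e by (rule mult_left_mono)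
    finally show ?thesis .
  qed
  let ?r = "R (t *\<^sub>R u + s *\<^sub>R v) - R (s *\<^sub>R v)"
  have G: "?G (x + t *\<^sub>R u + s *\<^sub>R v) - ?G (x + s *\<^sub>R v) = t *\<^sub>R L u + ?r"
    using L by (simp add: R_def linear_add linear_scale algebra_simps)
  have "h t - h 0 = t * ((t *\<^sub>R L u + ?r) \<bullet> v)"
    unfolding hs inner_diff_left[symmetric] G by simp
  also have "\<dots> = t\<^sup>2 * (L u \<bullet> v) + t * (?r \<bullet> v)"
    unfolding inner_add_left inner_scaleR_left by (simp add: distrib_left power2_eq_square)
  finally have "\<bar>h t - h 0 - t\<^sup>2 * (L u \<bullet> v)\<bar> = t * \<bar>?r \<bullet> v\<bar>"
    using t by (simp add: abs_mult)
  also have "\<dots> \<le> t * (norm ?r * norm v)"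
    using t by (intro mult_left_mono Cauchy_Schwarz_ineq2) simp
  also have "\<dots> \<le> t * ((e * (t * ?k) + e * (t * ?k)) * norm v)"
  proof -
    have "norm ?r \<le> norm (R (t *\<^sub>R u + s *\<^sub>R v)) + norm (R (s *\<^sub>R v))"
      by (rule norm_triangle_ineq4)
    also have "\<dots> \<le> e * (t * ?k) + e * (t * ?k)"
      using s by (intro add_mono R n1 n2) simp_all
    finally have "norm ?r * norm v \<le> (e * (t * ?k) + e * (t * ?k)) * norm v"
      by (rule mult_right_mono) simp
    then show ?thesis
      using t by (intro mult_left_mono) simp_all
  qed
  also have "\<dots> = t\<^sup>2 * (e * (2 * ?k) * norm v)"
    by (simp add: power2_eq_square)
  also have "h t - h 0 = f (x + t *\<^sub>R u + t *\<^sub>R v) - f (x + t *\<^sub>R u) - f (x + t *\<^sub>R v) + f x"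
    by (simp add: h_def)
  finally show ?thesis .
qed

text \<open>Symmetry of the second derivative at a single point: both \<open>L u \<bullet> v\<close> and \<open>L v \<bullet> u\<close> are limits of the
  same second difference quotient. No continuity of the second derivative is used.\<close>

lemma gradient_derivative_symmetric:
  fixes f :: "'a::euclidean_space \<Rightarrow> real"
  assumes diff: "\<forall>\<^sub>F y in nhds x. f differentiable (at y)"
    and L: "(gradient f has_derivative L) (at x)"
  shows "L u \<bullet> v = L v \<bullet> u"
proof (rule ccontr)
  assume ne: "L u \<bullet> v \<noteq> L v \<bullet> u"
  define k where "k = norm u + norm v"
  define K where "K = 2 * k * norm v + 2 * k * norm u"
  have K: "K \<ge> 0" by (simp add: K_def k_def)
  \<comment> \<open>With this \<open>e\<close> the total error \<open>t\<^sup>2 e K\<close> is too small to account for the discrepancy.\<close>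
  define e where "e = \<bar>L u \<bullet> v - L v \<bullet> u\<bar> / (2 * (K + 1))"
  have e: "e > 0" using ne K by (simp add: e_def)
  obtain d1 where d1: "d1 > 0" "\<And>y. norm (y - x) < d1 \<Longrightarrow> f differentiable (at y)"
    using diff by (auto simp: eventually_nhds_metric dist_norm)
  obtain d2 where d2: "d2 > 0" "\<And>y. norm (y - x) < d2
      \<Longrightarrow> norm (gradient f y - gradient f x - L (y - x)) \<le> e * norm (y - x)"
    using L e unfolding has_derivative_at_alt by blast
  define d where "d = min d1 d2"
  define t where "t = d / (2 * (k + 1))"
  have k: "k \<ge> 0" by (simp add: k_def)
  have t: "t > 0" using d1 d2 k by (simp add: t_def d_def)
  have "t * (norm u + norm v) = d * (k / (2 * (k + 1)))" by (simp add: t_def k_def)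
  also have "\<dots> < d * 1"
    using k d1 d2 by (intro mult_strict_left_mono) (auto simp: d_def)
  finally have small: "t * (norm u + norm v) < d" by simp
  define D where "D = f (x + t *\<^sub>R u + t *\<^sub>R v) - f (x + t *\<^sub>R u) - f (x + t *\<^sub>R v) + f x"
  have lin: "linear L" using L by (rule has_derivative_linear)
  have a: "\<bar>D - t\<^sup>2 * (L u \<bullet> v)\<bar> \<le> t\<^sup>2 * (e * (2 * k) * norm v)"
    unfolding D_def k_def
  proof (rule second_difference_estimate[OF lin t _ _ small])
  qed (use e in \<open>simp_all add: d_def d1(2) d2(2)\<close>)
  have "\<bar>(f (x + t *\<^sub>R v + t *\<^sub>R u) - f (x + t *\<^sub>R v) - f (x + t *\<^sub>R u) + f x) - t\<^sup>2 * (L v \<bullet> u)\<bar>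
      \<le> t\<^sup>2 * (e * (2 * (norm v + norm u)) * norm u)"
  proof (rule second_difference_estimate[OF lin t])
    show "t * (norm v + norm u) < d" using small by (simp add: add.commute)
  qed (use e in \<open>simp_all add: d_def d1(2) d2(2)\<close>)
  then have b: "\<bar>D - t\<^sup>2 * (L v \<bullet> u)\<bar> \<le> t\<^sup>2 * (e * (2 * k) * norm u)"
    by (simp add: D_def k_def algebra_simps)
  have "\<bar>t\<^sup>2 * (L u \<bullet> v) - t\<^sup>2 * (L v \<bullet> u)\<bar>
      \<le> t\<^sup>2 * (e * (2 * k) * norm v) + t\<^sup>2 * (e * (2 * k) * norm u)"
    using a b by linarith
  also have "\<dots> = t\<^sup>2 * (e * K)"
    by (simp add: K_def algebra_simps)
  finally have "t\<^sup>2 * \<bar>L u \<bullet> v - L v \<bullet> u\<bar> \<le> t\<^sup>2 * (e * K)"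
    by (simp add: right_diff_distrib[symmetric] abs_mult)
  then have "\<bar>L u \<bullet> v - L v \<bullet> u\<bar> \<le> e * K"
    using t by simp
  also have "\<dots> < e * (2 * (K + 1))" using e K by (intro mult_strict_left_mono) auto
  also have "\<dots> = \<bar>L u \<bullet> v - L v \<bullet> u\<bar>" using K by (simp add: e_def)
  finally show False by simp
qed

text \<open>The minimum of the Rayleigh quotient of a symmetric operator is one of its eigenvalues.\<close>

lemma symmetric_min_eigenvalue:
  fixes L :: "'a::euclidean_space \<Rightarrow> 'a"
  assumes L: "linear L" and sym: "\<And>u v. L u \<bullet> v = L v \<bullet> u"
  obtains v m where "v \<noteq> 0" "L v = m *\<^sub>R v" "\<And>u. m * (norm u)\<^sup>2 \<le> L u \<bullet> u"
proof -
  have bl: "bounded_linear L" using L by (simp add: linear_conv_bounded_linear)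
  have cont: "continuous_on (sphere 0 1) (\<lambda>u. L u \<bullet> u)"
    by (intro continuous_intros linear_continuous_on bl)
  have "sphere (0::'a) 1 \<noteq> {}" by simp
  then obtain v where v: "norm v = 1" and min: "\<And>u. norm u = 1 \<Longrightarrow> L v \<bullet> v \<le> L u \<bullet> u"
    using continuous_attains_inf[OF compact_sphere _ cont] by auto
  define m where "m = L v \<bullet> v"
  have ge: "m * (norm u)\<^sup>2 \<le> L u \<bullet> u" for u
  proof (cases "u = 0")
    case True
    then show ?thesis using L by (simp add: linear_0)
  next
    case False
    have "m \<le> L (sgn u) \<bullet> sgn u" unfolding m_def by (rule min) (simp add: norm_sgn False)
    also have "\<dots> = (L u \<bullet> u) / (norm u)\<^sup>2"
      using L by (simp add: sgn_div_norm linear_scale power2_eq_square divide_inverse)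
    finally show ?thesis using False by (simp add: pos_le_divide_eq)
  qed
  \<comment> \<open>This function of \<open>u\<close> has its global minimum at \<open>v\<close>, so its derivative there vanishes.\<close>
  have "((\<lambda>u. L u \<bullet> u - m * (u \<bullet> u)) has_derivative
      (\<lambda>h. (L v \<bullet> h + L h \<bullet> v) - m * (v \<bullet> h + h \<bullet> v))) (at v)"
    by (auto intro!: derivative_eq_intros bounded_linear.has_derivative[OF bl])
  moreover have "\<forall>u\<in>UNIV. L v \<bullet> v - m * (v \<bullet> v) \<le> L u \<bullet> u - m * (u \<bullet> u)"
    using ge v by (simp add: m_def power2_norm_eq_inner norm_eq_1)
  ultimately have "(\<lambda>h. (L v \<bullet> h + L h \<bullet> v) - m * (v \<bullet> h + h \<bullet> v)) = (\<lambda>h. 0)"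
    using differential_zero_maxmin[of v UNIV "\<lambda>u. L u \<bullet> u - m * (u \<bullet> u)"] by blast
  then have zero: "(L v \<bullet> h + L h \<bullet> v) - m * (v \<bullet> h + h \<bullet> v) = 0" for h
    by meson
  have "(L v - m *\<^sub>R v) \<bullet> h = 0" for h
    using zero[of h] sym[of h v]
    by (simp add: inner_diff_left inner_commute[of h v] algebra_simps)
  then have "L v = m *\<^sub>R v"
    by (metis inner_eq_zero_iff eq_iff_diff_eq_0)
  moreover have "v \<noteq> 0" using v by auto
  ultimately show ?thesis using that ge by blast
qed

lemma hessian_quadratic_form_ge:
  fixes f :: "'a::euclidean_space \<Rightarrow> real"
  assumes f: "twice_differentiable_at f x"
    and eig: "\<forall>\<mu>. basis_eigenvalue (hessian f x) \<mu> \<longrightarrow> \<mu> > \<delta>"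
  shows "\<delta> * (norm u)\<^sup>2 \<le> frechet_derivative (gradient f) (at x) u \<bullet> u"
proof -
  define L where "L = frechet_derivative (gradient f) (at x)"
  have L: "(gradient f has_derivative L) (at x)"
    using f by (simp add: twice_differentiable_at_def L_def frechet_derivative_works)
  have lin: "linear L" using L by (rule has_derivative_linear)
  have sym: "L u \<bullet> v = L v \<bullet> u" for u v
    using f L by (intro gradient_derivative_symmetric) (auto simp: twice_differentiable_at_def)
  obtain v m where v: "v \<noteq> 0" "L v = m *\<^sub>R v" and m: "\<And>u. m * (norm u)\<^sup>2 \<le> L u \<bullet> u"
    using symmetric_min_eigenvalue[OF lin sym] by blast
  have "(\<Sum>j\<in>Basis. hessian f x i j * (v \<bullet> j)) = m * (v \<bullet> i)" for i
  proof -
    have "(\<Sum>j\<in>Basis. hessian f x i j * (v \<bullet> j)) = L (\<Sum>j\<in>Basis. (v \<bullet> j) *\<^sub>R j) \<bullet> i"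
      using lin by (simp add: hessian_def L_def[symmetric] linear_sum linear_scale
          inner_sum_left mult.commute)
    then show ?thesis by (simp add: euclidean_representation v)
  qed
  with v have "basis_eigenvalue (hessian f x) m"
    by (auto simp: basis_eigenvalue_def)
  with eig have "\<delta> < m" by blast
  then have "\<delta> * (norm u)\<^sup>2 \<le> m * (norm u)\<^sup>2" by (intro mult_right_mono) auto
  with m[of u] show ?thesis by (simp add: L_def)
qed

text \<open>Taylor's formula of order two on the segment from \<open>a\<close> to \<open>b\<close>, which lies in \<open>N\<close>; minimality of
  \<open>a\<close> on the neighbourhood \<open>U\<close> makes the gradient vanish at \<open>a\<close>.\<close>

lemma strongly_convex_growth_at_minimum:
  fixes f :: "'a::euclidean_space \<Rightarrow> real"
  assumes N: "convex N" "a \<in> N" "b \<in> N"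
    and f: "\<forall>x\<in>N. twice_differentiable_at f x"
    and eig: "\<forall>x\<in>N. \<forall>\<mu>. basis_eigenvalue (hessian f x) \<mu> \<longrightarrow> \<mu> > \<delta>"
    and min: "open U" "a \<in> U" "\<And>x. x \<in> U \<Longrightarrow> f a \<le> f x"
  shows "\<delta> / 2 * (norm (b - a))\<^sup>2 \<le> f b - f a"
proof -
  define v where "v = b - a"
  have seg: "a + t *\<^sub>R v \<in> N" if "0 \<le> t" "t \<le> 1" for t
    using convexD_alt[OF N that] by (simp add: v_def algebra_simps)
  have diff: "f differentiable (at x)" if "x \<in> N" for x
    using f that eventually_nhds_x_imp_x unfolding twice_differentiable_at_def by blast
  define diff' where "diff' = (\<lambda>m t. if m = 0 then f (a + t *\<^sub>R v)
    else if m = (1::nat) then gradient f (a + t *\<^sub>R v) \<bullet> v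
    else frechet_derivative (gradient f) (at (a + t *\<^sub>R v)) v \<bullet> v)"
  have d1: "DERIV (diff' 0) t :> diff' (Suc 0) t" if "0 \<le> t" "t \<le> 1" for t
    using gradient_along_line[OF diff[OF seg[OF that]]] by (simp add: diff'_def)
  have d2: "DERIV (diff' 1) t :> diff' (Suc 1) t" if "0 \<le> t" "t \<le> 1" for t
  proof -
    let ?L = "frechet_derivative (gradient f) (at (a + t *\<^sub>R v))"
    have L: "(gradient f has_derivative ?L) (at (a + t *\<^sub>R v))"
      using f seg[OF that] by (simp add: twice_differentiable_at_def frechet_derivative_works)
    have "((\<lambda>t. a + t *\<^sub>R v) has_derivative (\<lambda>s. s *\<^sub>R v)) (at t)"
      by (auto intro!: derivative_eq_intros)
    from has_derivative_inner_left[OF has_derivative_compose[OF this L], of v]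
    have "((\<lambda>t. gradient f (a + t *\<^sub>R v) \<bullet> v) has_derivative (\<lambda>s. ?L (s *\<^sub>R v) \<bullet> v)) (at t)" .
    then show ?thesis
      using has_derivative_linear[OF L]
      by (simp add: diff'_def has_field_derivative_def linear_scale mult.commute[of _ "inner _ _"])
  qed
  have "\<forall>m t. m < 2 \<and> 0 \<le> t \<and> t \<le> 1 \<longrightarrow> DERIV (diff' m) t :> diff' (Suc m) t"
    using d1 d2 by (auto simp: less_2_cases_iff)
  then obtain t where t: "0 < t" "t < 1"
    and eq: "diff' 0 1 = (\<Sum>m<2. diff' m 0 / fact m * 1 ^ m) + diff' 2 t / fact 2 * 1 ^ 2"
    using Maclaurin[of 1 2 diff' "diff' 0"] by auto
  have "(\<lambda>h. h \<bullet> gradient f a) = (\<lambda>h. 0)"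
    using differential_zero_maxmin[OF min(2,1)] GDERIV_gradient[OF diff[OF N(2)]] min(3)
    unfolding gderiv_def by blast
  then have "v \<bullet> gradient f a = 0" by meson
  then have "f b - f a = diff' 2 t / 2"
    using eq by (simp add: diff'_def numeral_2_eq_2 v_def inner_commute)
  moreover have "\<delta> * (norm v)\<^sup>2 \<le> diff' 2 t"
    using hessian_quadratic_form_ge[of f "a + t *\<^sub>R v" \<delta> v] f eig seg[of t] t
    by (simp add: diff'_def)
  ultimately show ?thesis by (simp add: v_def)
qed

section \<open>Robustness under contamination\<close>

text \<open>Contamination lowers the score by a bias proportional to the overlap of \<open>w\<close> and \<open>g\<close>.\<close>

lemma contaminated_bias:
  fixes p0 w g :: "'x::euclidean_space \<Rightarrow> real"
  assumes "c > 0" "\<And>x. g x \<ge> 0"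
    and "integrable lebesgue (\<lambda>x. p0 x * g x powr \<gamma>)"
    and "integrable lebesgue (\<lambda>x. w x * g x powr \<gamma>)"
  shows "power_score \<gamma> (contaminated c0 p0 w) (\<lambda>x. c * g x)
    = power_score \<gamma> (\<lambda>x. c0 * p0 x) (\<lambda>x. c * g x)
      - (1 + \<gamma>) * ((1 - c0) * c powr \<gamma> * (LINT x|lebesgue. w x * g x powr \<gamma>))"
proof -
  have "(LINT x|lebesgue. contaminated c0 p0 w x * g x powr \<gamma>)
      = (LINT x|lebesgue. c0 * (p0 x * g x powr \<gamma>) + (1 - c0) * (w x * g x powr \<gamma>))"
    by (simp add: contaminated_def algebra_simps)
  also have "\<dots> = c0 * (LINT x|lebesgue. p0 x * g x powr \<gamma>)
      + (1 - c0) * (LINT x|lebesgue. w x * g x powr \<gamma>)"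
    using assms by simp
  finally show ?thesis
    using assms by (simp add: power_score_scaled mult.assoc) (simp add: algebra_simps)
qed

theorem theorem2:
  fixes \<gamma> \<delta> :: real
  assumes "\<gamma> > 0" and "\<delta> > 0"
  shows "\<exists>C. \<forall>(\<phi> :: real \<Rightarrow> real) (\<Theta> :: (real ^ 'd) set)
      (p :: real ^ 'd \<Rightarrow> 'x::euclidean_space \<Rightarrow> real) \<theta>\<^sub>0 c\<^sub>0 (w :: 'x \<Rightarrow> real) c\<^sub>1 \<theta>\<^sub>1 N.
    let q = contaminated c\<^sub>0 (p \<theta>\<^sub>0) w;
        f\<^sub>0 = (\<lambda>(c, \<theta>). power_score \<gamma> (\<lambda>x. c\<^sub>0 * p \<theta>\<^sub>0 x) (\<lambda>x. c * p \<theta> x));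
        f\<^sub>1 = (\<lambda>(c, \<theta>). power_score \<gamma> q (\<lambda>x. c * p \<theta> x));
        \<epsilon>\<^sub>1 = (LINT x|lebesgue. w x * p \<theta>\<^sub>1 x powr \<gamma>)
    in \<phi> 1 = -1 \<and> (\<forall>z\<ge>0. \<phi> z \<ge> - (z powr (1 + \<gamma>)))
      \<and> open \<Theta> \<and> (\<forall>\<theta>\<in>\<Theta>. prob_density (p \<theta>)) \<and> prob_density w
      \<and> (\<forall>\<theta>\<in>\<Theta>. integrable lebesgue (\<lambda>x. p \<theta> x powr (1 + \<gamma>)))
      \<and> (\<forall>\<theta>\<in>\<Theta>. integrable lebesgue (\<lambda>x. w x * p \<theta> x powr \<gamma>))
      \<and> \<theta>\<^sub>0 \<in> \<Theta> \<and> 0 < c\<^sub>0 \<and> c\<^sub>0 \<le> 1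
      \<and> unique_minimizer (\<lambda>(c, \<theta>). holder_score \<gamma> \<phi> q (\<lambda>x. c * p \<theta> x))
           ({0<..} \<times> \<Theta>) (c\<^sub>1, \<theta>\<^sub>1)
      \<and> c\<^sub>1 \<le> 1
      \<and> convex N \<and> N \<subseteq> {0<..} \<times> \<Theta>
      \<and> {\<xi> \<in> {0<..1} \<times> \<Theta>. f\<^sub>1 \<xi> \<le> f\<^sub>1 (c\<^sub>1, \<theta>\<^sub>1) + (1 + \<gamma>) * \<epsilon>\<^sub>1} \<subseteq> N
      \<and> (\<forall>\<xi>\<in>N. twice_differentiable_at f\<^sub>0 \<xi>)
      \<and> (\<forall>\<xi>\<in>N. \<forall>\<mu>. basis_eigenvalue (hessian f\<^sub>0 \<xi>) \<mu> \<longrightarrow> \<mu> > \<delta>)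
      \<longrightarrow> norm ((c\<^sub>1, \<theta>\<^sub>1) - (c\<^sub>0, \<theta>\<^sub>0)) \<le> C * sqrt \<epsilon>\<^sub>1"
proof -
  have bound: "norm ((c1, \<theta>1) - (c0, \<theta>0)) \<le> sqrt (2 * (1 + \<gamma>) / \<delta>)
      * sqrt (LINT x|lebesgue. w x * p \<theta>1 x powr \<gamma>)"
    if phi: "\<phi> 1 = -1" "\<forall>z\<ge>0. \<phi> z \<ge> - (z powr (1 + \<gamma>))"
      and Theta: "open \<Theta>" and dens: "\<forall>\<theta>\<in>\<Theta>. prob_density (p \<theta>)" and w: "prob_density w"
      and int: "\<forall>\<theta>\<in>\<Theta>. integrable lebesgue (\<lambda>x. p \<theta> x powr (1 + \<gamma>))"
      and intw: "\<forall>\<theta>\<in>\<Theta>. integrable lebesgue (\<lambda>x. w x * p \<theta> x powr \<gamma>)"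
      and th0: "\<theta>0 \<in> \<Theta>" and c0: "0 < c0" "c0 \<le> 1"
      and min: "unique_minimizer
        (\<lambda>(c, \<theta>). holder_score \<gamma> \<phi> (contaminated c0 (p \<theta>0) w) (\<lambda>x. c * p \<theta> x))
        ({0<..} \<times> \<Theta>) (c1, \<theta>1)"
      and c1_le: "c1 \<le> 1" and N: "convex N"
      and sub: "{\<xi> \<in> {0<..1} \<times> \<Theta>.
          (\<lambda>(c, \<theta>). power_score \<gamma> (contaminated c0 (p \<theta>0) w) (\<lambda>x. c * p \<theta> x)) \<xi>
          \<le> (\<lambda>(c, \<theta>). power_score \<gamma> (contaminated c0 (p \<theta>0) w) (\<lambda>x. c * p \<theta> x)) (c1, \<theta>1)
            + (1 + \<gamma>) * (LINT x|lebesgue. w x * p \<theta>1 x powr \<gamma>)} \<subseteq> N"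
      and diff: "\<forall>\<xi>\<in>N. twice_differentiable_at
          (\<lambda>(c, \<theta>). power_score \<gamma> (\<lambda>x. c0 * p \<theta>0 x) (\<lambda>x. c * p \<theta> x)) \<xi>"
      and eig: "\<forall>\<xi>\<in>N. \<forall>\<mu>. basis_eigenvalue (hessian
          (\<lambda>(c, \<theta>). power_score \<gamma> (\<lambda>x. c0 * p \<theta>0 x) (\<lambda>x. c * p \<theta> x)) \<xi>) \<mu> \<longrightarrow> \<mu> > \<delta>"
    for \<phi> :: "real \<Rightarrow> real" and \<Theta> :: "(real ^ 'd) set"
      and p :: "real ^ 'd \<Rightarrow> 'x \<Rightarrow> real" and \<theta>0 c0 and w :: "'x \<Rightarrow> real" and c1 \<theta>1 N
  proof -
    define q where "q = contaminated c0 (p \<theta>0) w"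
    define f0 where "f0 = (\<lambda>(c, \<theta>). power_score \<gamma> (\<lambda>x. c0 * p \<theta>0 x) (\<lambda>x. c * p \<theta> x))"
    define f1 where "f1 = (\<lambda>(c, \<theta>). power_score \<gamma> q (\<lambda>x. c * p \<theta> x))"
    define W where "W = (\<lambda>\<theta>. LINT x|lebesgue. w x * p \<theta> x powr \<gamma>)"
    note sub = sub[folded q_def, folded f1_def]
      and diff = diff[folded f0_def] and eig = eig[folded f0_def]
    have nonneg: "p \<theta> x \<ge> 0" and meas: "p \<theta> \<in> borel_measurable lebesgue" if "\<theta> \<in> \<Theta>" for \<theta> x
      using dens that by (auto simp: prob_density_def)
    have w_nonneg: "w x \<ge> 0" for x using w by (simp add: prob_density_def)
    have q_nonneg: "q x \<ge> 0" for x
      using nonneg[OF th0] w_nonneg c0 by (simp add: q_def contaminated_def)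
    have c1: "c1 > 0" and th1: "\<theta>1 \<in> \<Theta>"
      using min by (auto simp: unique_minimizer_def is_arg_min_def)
    have pos: "0 < (LINT x|lebesgue. p \<theta> x powr (1 + \<gamma>))" if "\<theta> \<in> \<Theta>" for \<theta>
      using prob_density_integral_powr_pos dens int that by blast
    have int0: "integrable lebesgue (\<lambda>x. p \<theta>0 x * p \<theta> x powr \<gamma>)" if "\<theta> \<in> \<Theta>" for \<theta>
      using integrable_mult_powr[of \<gamma> "p \<theta>0" "p \<theta>"] assms nonneg meas int th0 that by blast
    have W_nonneg: "W \<theta> \<ge> 0" for \<theta>
      unfolding W_def using w_nonneg by (intro integral_nonneg_AE) auto
    have bias: "f1 (c, \<theta>) = f0 (c, \<theta>) - (1 + \<gamma>) * ((1 - c0) * c powr \<gamma> * W \<theta>)"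
      if "c > 0" "\<theta> \<in> \<Theta>" for c \<theta>
      using contaminated_bias[of c "p \<theta>" "p \<theta>0" \<gamma> w c0] that nonneg int0 intw
      by (simp add: f0_def f1_def q_def W_def)
    have f0_min: "f0 (c0, \<theta>0) \<le> f0 \<xi>" if mem: "\<xi> \<in> {0<..} \<times> \<Theta>" for \<xi>
    proof -
      obtain c \<theta> where xi: "\<xi> = (c, \<theta>)" "c > 0" "\<theta> \<in> \<Theta>" using mem by auto
      have [measurable]: "p \<theta>0 \<in> borel_measurable lebesgue" "p \<theta> \<in> borel_measurable lebesgue"
        using meas th0 xi by auto
      have "power_score \<gamma> (\<lambda>x. c0 * p \<theta>0 x) (\<lambda>x. c0 * p \<theta>0 x)
          \<le> power_score \<gamma> (\<lambda>x. c0 * p \<theta>0 x) (\<lambda>x. c * p \<theta> x)"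
        using assms nonneg[OF th0] nonneg[OF xi(3)] c0 xi int th0
        by (intro power_score_self_le) (auto simp: powr_mult)
      then show ?thesis by (simp add: f0_def xi)
    qed
    have corr: "0 < (LINT x|lebesgue. q x * p \<theta>0 x powr \<gamma>)"
    proof -
      have split: "q x * p \<theta>0 x powr \<gamma>
          = c0 * (p \<theta>0 x * p \<theta>0 x powr \<gamma>) + (1 - c0) * (w x * p \<theta>0 x powr \<gamma>)" for x
        by (simp add: q_def contaminated_def algebra_simps)
      have self: "p \<theta>0 x * p \<theta>0 x powr \<gamma> = p \<theta>0 x powr (1 + \<gamma>)" for x
        using nonneg[OF th0, of x] by (cases "p \<theta>0 x = 0") (simp_all add: powr_add)
      have "(LINT x|lebesgue. q x * p \<theta>0 x powr \<gamma>)
          = c0 * (LINT x|lebesgue. p \<theta>0 x powr (1 + \<gamma>)) + (1 - c0) * W \<theta>0"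
        unfolding split self W_def using int intw th0 by simp
      then show ?thesis
        using c0 pos[OF th0] W_nonneg[of \<theta>0] by (simp add: add_pos_nonneg)
    qed
    have f1_min: "f1 (c1, \<theta>1) \<le> f1 (c0, \<theta>0)"
      using unique_minimizer_holder_score_power_score_le[OF assms(1) phi q_nonneg nonneg pos
          min[folded q_def] c0(1) th0 corr]
      by (simp add: f1_def)
    \<comment> \<open>Here \<open>c1 \<le> 1\<close> bounds the factor \<open>c1\<^sup>\<gamma>\<close> in the bias.\<close>
    have gap: "f0 (c1, \<theta>1) \<le> f1 (c1, \<theta>1) + (1 + \<gamma>) * W \<theta>1"
    proof -
      have "(1 - c0) * c1 powr \<gamma> * W \<theta>1 \<le> 1 * 1 * W \<theta>1"
        using c0 c1 c1_le assms W_nonneg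
        by (intro mult_right_mono mult_mono powr_le1) auto
      then have "(1 + \<gamma>) * ((1 - c0) * c1 powr \<gamma> * W \<theta>1) \<le> (1 + \<gamma>) * W \<theta>1"
        using assms by (intro mult_left_mono) auto
      then show ?thesis using bias[OF c1 th1] by simp
    qed
    have f1_le_f0: "f1 (c0, \<theta>0) \<le> f0 (c0, \<theta>0)"
      using bias[OF c0(1) th0] c0 assms W_nonneg[of \<theta>0] by simp
    have in_N: "(c, \<theta>) \<in> N"
      if "0 < c" "c \<le> 1" "\<theta> \<in> \<Theta>" "f1 (c, \<theta>) \<le> f1 (c1, \<theta>1) + (1 + \<gamma>) * W \<theta>1" for c \<theta>
      using that unfolding W_def by (intro subsetD[OF sub]) simp
    have "(c1, \<theta>1) \<in> N"
      using c1 c1_le th1 assms W_nonneg[of \<theta>1] by (intro in_N) auto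
    moreover have "f1 (c0, \<theta>0) \<le> f1 (c1, \<theta>1) + (1 + \<gamma>) * W \<theta>1"
      using f1_le_f0 f0_min[of "(c1, \<theta>1)"] gap c1 th1 by simp
    then have "(c0, \<theta>0) \<in> N"
      using c0 th0 by (intro in_N)
    ultimately have "\<delta> / 2 * (norm ((c1, \<theta>1) - (c0, \<theta>0)))\<^sup>2 \<le> f0 (c1, \<theta>1) - f0 (c0, \<theta>0)"
      using Theta th0 c0 diff eig f0_min N
      by (intro strongly_convex_growth_at_minimum[where U = "{0<..} \<times> \<Theta>"])
        (auto intro: open_Times)
    also have "\<dots> \<le> (1 + \<gamma>) * W \<theta>1"
      using gap f1_min f1_le_f0 by linarith
    finally have "(norm ((c1, \<theta>1) - (c0, \<theta>0)))\<^sup>2 \<le> 2 * (1 + \<gamma>) / \<delta> * W \<theta>1"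
      using assms by (simp add: field_simps)
    then have "norm ((c1, \<theta>1) - (c0, \<theta>0)) \<le> sqrt (2 * (1 + \<gamma>) / \<delta> * W \<theta>1)"
      by (rule real_le_rsqrt)
    then show ?thesis
      by (simp only: W_def real_sqrt_mult)
  qed
  show ?thesis
    unfolding Let_def
    by (intro exI[of _ "sqrt (2 * (1 + \<gamma>) / \<delta>)"] allI impI, elim conjE, rule bound; assumption)
qed

end
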